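(* Let $F:\mathbb{R}^n\times\mathbb{R}^m\to\mathbb{R}$ be a $\mathcal C^1$ function with $\operatorname{Saddle}(F)\neq\emptyset$. Suppose that (i) $F$ is globally convex-concave and linear in $z$; (ii) for each $(x_*,z_* )\in\operatorname{Saddle}(F)$, if $F(x,z_* )=F(x_*,z_* )$, then $(x,z_* )\in\operatorname{Saddle}(F)$. Then $\operatorname{Saddle}(F)$ is globally asymptotically stable under the saddle-point dynamics $X_{\text{sp}}$ of $F$ and, moreover, convergence of trajectories is to a point.
   Context: Saddle-point dynamics: for a continuously differentiable $F:\mathbb{R}^n\times\mathbb{R}^m\to\mathbb{R}$ it is $\dot x=-\nabla_xF(x,z)$, $\dot z=\nabla_zF(x,z)$, with vector field denoted $X_{\text{sp}}$. Trajectories are solutions on $t\ge 0$. Saddle points: $(x_*,z_* )$ is a (local min-max) saddle point of $F$ if there are open neighborhoods $\mathcal U_{x_*}\subset\mathbb{R}^n$ of $x_*$ and $\mathcal U_{z_*}\subset\mathbb{R}^m$ of $z_*$ with $F(x_*,z)\le F(x_*,z_* )\le F(x,z_* )$ for all $z\in\mathcal U_{z_*}$, $x\in\mathcal U_{x_*}$. $\operatorname{Saddle}(F)$ is the set of all such points; it is assumed nonempty. $F$ is globally convex-concave if $x\mapsto F(x,\bar z)$ is convex on $\mathbb{R}^n$ and $z\mapsto F(\bar x,z)$ is concave on $\mathbb{R}^m$ for all $(\bar x,\bar z)\in\mathbb{R}^n\times\mathbb{R}^m$. "Linear in $z$" means that for each $x$ the map $z\mapsto F(x,z)$ is affine (as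 for the Lagrangian of an equality-constrained problem), i.e. $\nabla_zF(x,z)$ does not depend on $z$. Stability: a set $\mathcal S$ of equilibria is globally asymptotically stable if for every $\epsilon>0$ there is an open set $W\supset\mathcal S$ such that every trajectory starting in $W$ stays within distance less than $\epsilon$ of $\mathcal S$ for all $t\ge0$, and the distance to $\mathcal S$ of every trajectory tends to $0$ as $t\to\infty$. "Convergence is to a point" means every trajectory converges to a single point of $\mathcal S$. *)

theory Defs
  imports "HOL-Analysis.Analysis"
begin

definition gradient :: "('a::real_inner \<Rightarrow> real) \<Rightarrow> 'a \<Rightarrow> 'a" where
  "gradient f x = (THE D. GDERIV f x :> D)"

lemma gradient_eqI:
  assumes "GDERIV f x :> D"
  shows "gradient f x = D"
  unfolding gradient_def
proof (rule the_equality)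
  fix D' assume "GDERIV f x :> D'"
  then have "(\<lambda>h. h \<bullet> D') = (\<lambda>h. h \<bullet> D)"
    using assms unfolding gderiv_def by (rule has_derivative_unique)
  then have "h \<bullet> D' = h \<bullet> D" for h
    by (rule fun_cong)
  then show "D' = D"
    using vector_eq_ldot by blast
qed (rule assms)

definition C1 :: "('a::real_inner \<Rightarrow> real) \<Rightarrow> bool" where
  "C1 f \<longleftrightarrow> (\<forall>x. f differentiable (at x)) \<and> continuous_on UNIV (gradient f)"

text \<open>Saddle points are local: the neighbourhoods depend on the point.\<close>

definition is_saddle :: "('a::topological_space \<times> 'b::topological_space \<Rightarrow> real) \<Rightarrow> 'a \<times> 'b \<Rightarrow> bool"
  where
  "is_saddle F = (\<lambda>(x', z'). \<exists>U V. open U \<and> x' \<in> U \<and> open V \<and> z' \<in> V \<and>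
     (\<forall>x\<in>U. \<forall>z\<in>V. F (x', z) \<le> F (x', z') \<and> F (x', z') \<le> F (x, z')))"

definition Saddle :: "('a::topological_space \<times> 'b::topological_space \<Rightarrow> real) \<Rightarrow> ('a \<times> 'b) set" where
  "Saddle F = {p. is_saddle F p}"

definition convex_concave :: "('a::real_vector \<times> 'b::real_vector \<Rightarrow> real) \<Rightarrow> bool" where
  "convex_concave F \<longleftrightarrow>
     (\<forall>z. convex_on UNIV (\<lambda>x. F (x, z))) \<and> (\<forall>x. concave_on UNIV (\<lambda>z. F (x, z)))"

text \<open>As for the Lagrangian of an equality-constrained problem, ``linear'' means affine.\<close>

definition linear_in_z :: "('a \<times> 'b::real_vector \<Rightarrow> real) \<Rightarrow> bool" where
  "linear_in_z F \<longleftrightarrow> (\<forall>x. \<exists>l c. linear l \<and> (\<forall>z. F (x, z) = l z + c))"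

definition X_sp :: "('a::real_inner \<times> 'b::real_inner \<Rightarrow> real) \<Rightarrow> 'a \<times> 'b \<Rightarrow> 'a \<times> 'b" where
  "X_sp F = (\<lambda>(x, z). (- gradient (\<lambda>x'. F (x', z)) x, gradient (\<lambda>z'. F (x, z')) z))"

text \<open>The derivative at \<open>0\<close> is one-sided; the values of a trajectory at negative times are
  irrelevant.\<close>

definition trajectory :: "('a::real_normed_vector \<Rightarrow> 'a) \<Rightarrow> (real \<Rightarrow> 'a) \<Rightarrow> bool" where
  "trajectory X \<phi> \<longleftrightarrow> (\<forall>t\<ge>0. (\<phi> has_vector_derivative X (\<phi> t)) (at t within {0..}))"

definition globally_asymptotically_stable ::
    "('a::real_normed_vector \<Rightarrow> 'a) \<Rightarrow> 'a set \<Rightarrow> bool" where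
  "globally_asymptotically_stable X S \<longleftrightarrow>
     (\<forall>p\<in>S. X p = 0) \<and>
     (\<forall>\<epsilon>>0. \<exists>W. open W \<and> S \<subseteq> W \<and>
        (\<forall>\<phi>. trajectory X \<phi> \<and> \<phi> 0 \<in> W \<longrightarrow> (\<forall>t\<ge>0. infdist (\<phi> t) S < \<epsilon>))) \<and>
     (\<forall>\<phi>. trajectory X \<phi> \<longrightarrow> ((\<lambda>t. infdist (\<phi> t) S) \<longlongrightarrow> 0) at_top)"

definition pointwise_convergent ::
    "('a::real_normed_vector \<Rightarrow> 'a) \<Rightarrow> 'a set \<Rightarrow> bool" where
  "pointwise_convergent X S \<longleftrightarrow> (\<forall>\<phi>. trajectory X \<phi> \<longrightarrow> (\<exists>p\<in>S. (\<phi> \<longlongrightarrow> p) at_top))"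

end

theory Submission
  imports Defs
begin

text \<open>The squared distance \<open>V\<close> to a saddle point \<open>(x\<^sub>s, z\<^sub>s)\<close> satisfies
  \<open>V' \<le> 2 (F (x\<^sub>s, z\<^sub>s) - F (x, z\<^sub>s)) \<le> 0\<close> along trajectories. Since the field is merely
  continuous, solutions need not be unique and limit sets are awkward to handle by LaSalle's
  principle; Barbalat's lemma is used twice instead. Applied to \<open>V\<close> it gives
  \<open>F (x, z\<^sub>s) \<rightarrow> F (x\<^sub>s, z\<^sub>s)\<close>, so by hypothesis (ii), and because the \<open>z\<close>-gradient is
  independent of \<open>z\<close>, the \<open>z\<close>-gradient tends to \<open>0\<close> along the trajectory. Hence \<open>F\<close> itself
  converges along the trajectory, and its derivative there is the squared norm of the
  \<open>z\<close>-gradient minus that of the \<open>x\<close>-gradient, so Barbalat's lemma shows that the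
  \<open>x\<close>-gradient vanishes in the limit too. Every limit point is therefore a saddle point, and
  the distance to it is nonincreasing.\<close>

section \<open>Real analysis on the half-line: mean values, monotone limits, Barbalat's
  lemma\<close>

lemma DERIV_within_atLeast_mvt:
  fixes h h' :: "real \<Rightarrow> real"
  assumes "\<And>t. t \<ge> 0 \<Longrightarrow> (h has_real_derivative h' t) (at t within {0..})"
    and "0 \<le> a" "a < b"
  obtains s where "a < s" "s < b" "h b - h a = h' s * (b - a)"
proof -
  \<comment> \<open>Shrinking \<open>{0..}\<close> to \<open>{a..b}\<close> also covers
    \<open>a = 0\<close>, where only a one-sided derivative is given.\<close>
  have "(h has_derivative (*) (h' t)) (at t within {a..b})" if "a \<le> t" "t \<le> b" for t
    using assms(1)[of t] \<open>0 \<le> a\<close> that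
    by (auto simp: has_field_derivative_def intro: has_derivative_subset)
  from mvt_simple[OF \<open>a < b\<close> this] show thesis
    using that by auto
qed

lemma DERIV_nonpos_atLeast_antimono:
  fixes h h' :: "real \<Rightarrow> real"
  assumes "\<And>t. t \<ge> 0 \<Longrightarrow> (h has_real_derivative h' t) (at t within {0..})"
    and "\<And>t. t \<ge> 0 \<Longrightarrow> h' t \<le> 0"
    and "0 \<le> a" "a \<le> b"
  shows "h b \<le> h a"
proof (cases "a = b")
  case False
  with assms obtain s where "a < s" "h b - h a = h' s * (b - a)"
    by (metis DERIV_within_atLeast_mvt order_le_less)
  with assms show ?thesis
    by (smt (verit) mult_nonpos_nonneg)
qed auto

lemma decreasing_bounded_below_convergent_at_top:
  fixes h :: "real \<Rightarrow> real"
  assumes dec: "\<And>a b. 0 \<le> a \<Longrightarrow> a \<le> b \<Longrightarrow> h b \<le> h a"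
    and lb: "\<And>t. t \<ge> 0 \<Longrightarrow> m \<le> h t"
  obtains L where "(h \<longlongrightarrow> L) at_top"
proof
  have bdd: "bdd_below (h ` {0..})"
    using lb by (intro bdd_belowI2[of _ m]) auto
  show "(h \<longlongrightarrow> Inf (h ` {0..})) at_top"
  proof (rule decreasing_tendsto)
    show "\<forall>\<^sub>F t in at_top. Inf (h ` {0..}) \<le> h t"
      using eventually_ge_at_top[of 0] by eventually_elim (auto intro: cInf_lower bdd)
  next
    fix y assume "Inf (h ` {0..}) < y"
    then obtain s where s: "s \<ge> 0" "h s < y"
      using cInf_less_iff[OF _ bdd] by auto
    show "\<forall>\<^sub>F t in at_top. h t < y"
      using eventually_ge_at_top[of s]
    proof eventually_elim
      case (elim t)
      then show ?case
        using dec[OF s(1)] s(2) by fastforce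
    qed
  qed
qed

text \<open>If \<open>u t \<ge> \<epsilon>\<close> at a late time, uniform continuity keeps
  \<open>u\<close> above \<open>\<epsilon> / 2\<close> for a further time \<open>d\<close>, while
  \<open>e\<close> is below \<open>\<epsilon> / 4\<close>. So \<open>h' < - \<epsilon> / 4\<close>
  there and \<open>h\<close> drops by more than \<open>\<epsilon> * d / 4\<close>, although both its
  values lie within \<open>\<epsilon> * d / 8\<close> of \<open>L\<close>. The error term
  \<open>e\<close> admits functions \<open>h\<close> that need not be monotone.\<close>

lemma barbalat:
  fixes h h' u e :: "real \<Rightarrow> real"
  assumes deriv: "\<And>t. t \<ge> 0 \<Longrightarrow> (h has_real_derivative h' t) (at t within {0..})"
    and bound: "\<And>t. t \<ge> 0 \<Longrightarrow> h' t \<le> e t - u t"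
    and nonneg: "\<And>t. t \<ge> 0 \<Longrightarrow> u t \<ge> 0"
    and uc: "uniformly_continuous_on {0..} u"
    and h: "(h \<longlongrightarrow> L) at_top"
    and e: "(e \<longlongrightarrow> 0) at_top"
  shows "(u \<longlongrightarrow> 0) at_top"
proof (rule tendstoI)
  fix \<epsilon> :: real assume "\<epsilon> > 0"
  then obtain d where d: "d > 0"
    "\<And>s t. s \<ge> 0 \<Longrightarrow> t \<ge> 0 \<Longrightarrow> dist s t < d \<Longrightarrow> dist (u s) (u t) < \<epsilon> / 2"
    using uc unfolding uniformly_continuous_on_def by (metis atLeast_iff half_gt_zero)
  have "\<forall>\<^sub>F t in at_top. dist (h t) L < \<epsilon> * d / 8"
    using h \<open>\<epsilon> > 0\<close> d(1) by (intro tendstoD) auto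
  then obtain T1 where T1: "\<And>t. t \<ge> T1 \<Longrightarrow> dist (h t) L < \<epsilon> * d / 8"
    by (auto simp: eventually_at_top_linorder)
  have "\<forall>\<^sub>F t in at_top. dist (e t) 0 < \<epsilon> / 4"
    using e \<open>\<epsilon> > 0\<close> by (intro tendstoD) auto
  then obtain T2 where T2: "\<And>t. t \<ge> T2 \<Longrightarrow> dist (e t) 0 < \<epsilon> / 4"
    by (auto simp: eventually_at_top_linorder)
  show "\<forall>\<^sub>F t in at_top. dist (u t) 0 < \<epsilon>"
    using eventually_ge_at_top[of "max 0 (max T1 T2)"]
  proof eventually_elim
    case (elim t)
    show ?case
    proof (rule ccontr)
      assume "\<not> dist (u t) 0 < \<epsilon>"
      with nonneg[of t] elim have ut: "u t \<ge> \<epsilon>"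
        by (simp add: dist_real_def)
      obtain s where s: "t < s" "s < t + d" "h (t + d) - h t = h' s * d"
        using DERIV_within_atLeast_mvt[OF deriv, of t "t + d"] elim d(1) by auto
      have "dist (u s) (u t) < \<epsilon> / 2"
        using s elim by (intro d(2)) (auto simp: dist_real_def)
      moreover have "e s < \<epsilon> / 4"
        using T2[of s] s elim by (auto simp: dist_real_def)
      ultimately have "h' s < - (\<epsilon> / 4)"
        using bound[of s] s elim ut unfolding dist_real_def by linarith
      then have "h' s * d < - (\<epsilon> / 4) * d"
        using d(1) by (rule mult_strict_right_mono)
      moreover have "dist (h t) L < \<epsilon> * d / 8" "dist (h (t + d)) L < \<epsilon> * d / 8"
        using T1 elim d(1) by auto
      ultimately show False
        using s(3) unfolding dist_real_def by argo
    qed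
  qed
qed

text \<open>Reduces a limit in continuous time to a check at limit points: if \<open>k\<close>
  stayed away from \<open>0\<close> at arbitrarily late times, compactness would yield a limit point
  of such times, and by continuity \<open>k\<close> could not vanish there.\<close>

lemma tendsto_zero_at_top_if_compact:
  fixes \<phi> :: "real \<Rightarrow> 'a::metric_space" and k :: "'a \<Rightarrow> 'b::real_normed_vector"
  assumes K: "compact K" "\<And>t. t \<ge> 0 \<Longrightarrow> \<phi> t \<in> K"
    and k: "continuous_on UNIV k"
    and zero: "\<And>l r. filterlim r at_top sequentially \<Longrightarrow> (\<lambda>n. \<phi> (r n)) \<longlonglongrightarrow> l \<Longrightarrow> k l = 0"
  shows "((\<lambda>t. k (\<phi> t)) \<longlongrightarrow> 0) at_top"
proof (rule tendstoI, rule ccontr)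
  fix \<epsilon> :: real
  assume "\<epsilon> > 0" "\<not> (\<forall>\<^sub>F t in at_top. dist (k (\<phi> t)) 0 < \<epsilon>)"
  then have "\<exists>t. t \<ge> real n \<and> dist (k (\<phi> t)) 0 \<ge> \<epsilon>" for n
    by (auto simp: eventually_at_top_linorder not_less)
  then obtain r where r: "\<And>n. r n \<ge> real n" "\<And>n. dist (k (\<phi> (r n))) 0 \<ge> \<epsilon>"
    by metis
  have "\<phi> (r n) \<in> K" for n
    using r(1)[of n] by (intro K(2)) linarith
  then obtain l q where q: "strict_mono (q :: nat \<Rightarrow> nat)" "((\<lambda>n. \<phi> (r n)) \<circ> q) \<longlonglongrightarrow> l"
    using K(1) unfolding compact_def by meson
  have "filterlim r at_top sequentially"
    by (rule filterlim_at_top_mono[OF filterlim_real_sequentially]) (use r in auto)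
  then have "filterlim (\<lambda>n. r (q n)) at_top sequentially"
    using filterlim_compose filterlim_subseq[OF q(1)] by blast
  then have "k l = 0"
    using q(2) by (intro zero) (auto simp: o_def)
  moreover have "(\<lambda>n. k (\<phi> (r (q n)))) \<longlonglongrightarrow> k l"
    using k q(2) by (intro isCont_tendsto_compose[of l k]) (auto simp: continuous_on_eq_continuous_at o_def)
  ultimately have "\<forall>\<^sub>F n in sequentially. dist (k (\<phi> (r (q n)))) 0 < \<epsilon>"
    using \<open>\<epsilon> > 0\<close> by (intro tendstoD) auto
  then show False
    using r(2) by (auto simp: eventually_sequentially not_less[symmetric])
qed

section \<open>Gradients: convexity, representation, extrema\<close>

lemma convex_on_gradient_ineq:
  assumes "convex_on UNIV f" and "GDERIV f x :> D"
  shows "f y \<ge> f x + (y - x) \<bullet> D"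
proof -
  \<comment> \<open>Restriction to the line through \<open>x\<close> and \<open>y\<close> reduces
    the claim to the tangent inequality for convex functions of one real variable.\<close>
  let ?g = "\<lambda>s::real. f (x + s *\<^sub>R (y - x))"
  have "convex_on UNIV ?g"
  proof (rule convex_onI)
    fix s a b :: real assume "0 < s" "s < 1"
    moreover have "x + ((1 - s) *\<^sub>R a + s *\<^sub>R b) *\<^sub>R (y - x)
        = (1 - s) *\<^sub>R (x + a *\<^sub>R (y - x)) + s *\<^sub>R (x + b *\<^sub>R (y - x))"
      by (simp add: algebra_simps)
    ultimately show "?g ((1 - s) *\<^sub>R a + s *\<^sub>R b) \<le> (1 - s) * ?g a + s * ?g b"
      using convex_onD[OF assms(1), of s] by simp
  qed simp
  moreover have "(?g has_real_derivative (y - x) \<bullet> D) (at 0)"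
  proof -
    have "((\<lambda>s. x + s *\<^sub>R (y - x)) has_derivative (\<lambda>s. s *\<^sub>R (y - x))) (at 0)"
      by (auto intro!: derivative_eq_intros)
    moreover have "(f has_derivative (\<lambda>h. h \<bullet> D)) (at (x + 0 *\<^sub>R (y - x)))"
      using assms(2) by (simp add: gderiv_def)
    ultimately have "(?g has_derivative (\<lambda>s. (s *\<^sub>R (y - x)) \<bullet> D)) (at 0)"
      by (rule has_derivative_compose)
    then show ?thesis
      unfolding has_field_derivative_def by (rule has_derivative_eq_rhs) (simp add: fun_eq_iff)
  qed
  ultimately have "?g 1 - ?g 0 \<ge> (y - x) \<bullet> D * (1 - 0)"
    by (intro convex_on_imp_above_tangent[where A = UNIV]) auto
  then show ?thesis by simp
qed

text \<open>Riesz representation: the derivative \<open>f'\<close> is the inner product with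
  \<open>adjoint f' 1\<close>, so the definite description in \<open>gradient\<close> does
  denote.\<close>

lemma GDERIV_gradient:
  fixes f :: "'a::euclidean_space \<Rightarrow> real"
  assumes "f differentiable (at x)"
  shows "GDERIV f x :> gradient f x"
proof -
  obtain f' where f': "(f has_derivative f') (at x)"
    using assms by (auto simp: differentiable_def)
  then have "linear f'"
    by (rule has_derivative_linear)
  then have "f' = (\<lambda>h. h \<bullet> adjoint f' 1)"
    using adjoint_works[of f' _ 1] by auto
  with f' have "GDERIV f x :> adjoint f' 1"
    by (simp add: gderiv_def)
  then show ?thesis
    using gradient_eqI by metis
qed

lemma GDERIV_local_extremum:
  assumes "GDERIV f x :> D" and "open U" "x \<in> U"
    and "(\<forall>y\<in>U. f x \<le> f y) \<or> (\<forall>y\<in>U. f y \<le> f x)"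
  shows "D = 0"
proof -
  have "(\<lambda>h. h \<bullet> D) = (\<lambda>h. 0)"
    using differential_zero_maxmin[OF assms(3,2)] assms(1,4) unfolding gderiv_def by auto
  then have "D \<bullet> D = 0"
    by (rule fun_cong)
  then show ?thesis by simp
qed

section \<open>Functions convex in \<open>x\<close> and affine in \<open>z\<close>, and their saddle
  points\<close>

locale convex_affine_saddle =
  fixes F :: "'a::euclidean_space \<times> 'b::euclidean_space \<Rightarrow> real"
  assumes C1: "C1 F"
    and nonempty: "Saddle F \<noteq> {}"
    and convex_concave: "convex_concave F"
    and linear: "linear_in_z F"
    and level: "\<And>x\<^sub>s z\<^sub>s x. (x\<^sub>s, z\<^sub>s) \<in> Saddle F \<Longrightarrow> F (x, z\<^sub>s) = F (x\<^sub>s, z\<^sub>s) \<Longrightarrow> (x, z\<^sub>s) \<in> Saddle F"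
begin

text \<open>Components of the full gradient rather than gradients of sections, so that joint
  continuity follows directly from \<open>C1\<close>. \<open>GDERIV_x\<close> and
  \<open>GDERIV_z\<close> identify them with the partial gradients.\<close>

definition Gx where "Gx p = fst (gradient F p)"
definition Gz where "Gz p = snd (gradient F p)"

lemma continuous_on_Gx: "continuous_on UNIV Gx" and continuous_on_Gz: "continuous_on UNIV Gz"
  using C1 unfolding C1_def Gx_def[abs_def] Gz_def[abs_def] by (auto intro: continuous_intros)

lemma has_derivative_F: "(F has_derivative (\<lambda>h. fst h \<bullet> Gx p + snd h \<bullet> Gz p)) (at p)"
proof -
  have "GDERIV F p :> gradient F p"
    using C1 unfolding C1_def by (intro GDERIV_gradient) blast
  then show ?thesis
    by (simp add: gderiv_def Gx_def Gz_def inner_prod_def)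
qed

lemma continuous_on_F: "continuous_on UNIV F"
  using has_derivative_F by (meson continuous_at_imp_continuous_on has_derivative_continuous)

lemma GDERIV_x: "GDERIV (\<lambda>x. F (x, z)) x :> Gx (x, z)"
proof -
  have "((\<lambda>x. (x, z)) has_derivative (\<lambda>h. (h, 0))) (at x)"
    by (auto intro!: derivative_eq_intros)
  from has_derivative_compose[OF this has_derivative_F] show ?thesis
    by (simp add: gderiv_def)
qed

lemma GDERIV_z: "GDERIV (\<lambda>z. F (x, z)) z :> Gz (x, z)"
proof -
  have "((\<lambda>z. (x, z)) has_derivative (\<lambda>h. (0, h))) (at z)"
    by (auto intro!: derivative_eq_intros)
  from has_derivative_compose[OF this has_derivative_F] show ?thesis
    by (simp add: gderiv_def)
qed

lemma X_sp_eq: "X_sp F p = (- Gx p, Gz p)"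
  by (cases p) (simp add: X_sp_def gradient_eqI[OF GDERIV_x] gradient_eqI[OF GDERIV_z])

lemma F_x_ineq: "F (y, z) \<ge> F (x, z) + (y - x) \<bullet> Gx (x, z)"
  using convex_on_gradient_ineq[OF _ GDERIV_x] convex_concave by (auto simp: convex_concave_def)

text \<open>An affine function equals its first-order expansion, since its linear part is its
  derivative.\<close>

lemma F_z_eq: "F (x, w) = F (x, z) + (w - z) \<bullet> Gz (x, z)"
proof -
  obtain l c where l: "linear l" "\<And>z. F (x, z) = l z + c"
    using linear unfolding linear_in_z_def by metis
  have "((\<lambda>z. F (x, z)) has_derivative l) (at z)"
    using linear_imp_has_derivative[OF l(1)] l(2) by (auto intro!: derivative_eq_intros)
  then have "l = (\<lambda>h. h \<bullet> Gz (x, z))"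
    using GDERIV_z[of x z] unfolding gderiv_def by (rule has_derivative_unique)
  then show ?thesis
    unfolding l(2) by (simp add: inner_diff_left)
qed

lemma Gz_const: "Gz (x, w) = Gz (x, z)"
proof -
  have "h \<bullet> Gz (x, w) = h \<bullet> Gz (x, z)" for h
    \<comment> \<open>Expanding \<open>F (x, w + h)\<close> both at \<open>w\<close> and at
      \<open>z\<close> isolates the increment in direction \<open>h\<close>.\<close>
    using F_z_eq[of x "w + h" w] F_z_eq[of x "w + h" z] F_z_eq[of x w z]
    by (simp add: inner_diff_left inner_add_left)
  then show ?thesis
    using vector_eq_ldot by blast
qed

text \<open>A local saddle point is critical in each variable. Conversely, convexity in
  \<open>x\<close> and affinity in \<open>z\<close> give the saddle inequalities at a critical point
  on the whole space, so both neighbourhoods can be \<open>UNIV\<close> and every local saddle point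
  is global.\<close>

lemma Saddle_iff: "p \<in> Saddle F \<longleftrightarrow> Gx p = 0 \<and> Gz p = 0"
proof (cases p)
  case (Pair x z)
  show ?thesis
  proof
    assume "p \<in> Saddle F"
    then obtain U V where UV: "open U" "x \<in> U" "open V" "z \<in> V"
      "\<And>x' z'. x' \<in> U \<Longrightarrow> z' \<in> V \<Longrightarrow> F (x, z') \<le> F (x, z) \<and> F (x, z) \<le> F (x', z)"
      unfolding Pair Saddle_def is_saddle_def by auto
    have "Gx (x, z) = 0"
      by (rule GDERIV_local_extremum[OF GDERIV_x UV(1,2)]) (use UV in auto)
    moreover have "Gz (x, z) = 0"
      by (rule GDERIV_local_extremum[OF GDERIV_z UV(3,4)]) (use UV in auto)
    ultimately show "Gx p = 0 \<and> Gz p = 0"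
      by (simp add: Pair)
  next
    assume "Gx p = 0 \<and> Gz p = 0"
    then have "F (x, z') \<le> F (x, z) \<and> F (x, z) \<le> F (x', z)" for x' z'
      using F_x_ineq[of x z x'] F_z_eq[of x z' z] by (simp add: Pair)
    then show "p \<in> Saddle F"
      unfolding Pair Saddle_def is_saddle_def by (auto intro!: exI[of _ UNIV])
  qed
qed

lemma X_sp_eq_0_iff: "X_sp F p = 0 \<longleftrightarrow> p \<in> Saddle F"
  by (simp add: X_sp_eq Saddle_iff zero_prod_def)

lemma Saddle_le: "(x\<^sub>s, z\<^sub>s) \<in> Saddle F \<Longrightarrow> F (x\<^sub>s, z\<^sub>s) \<le> F (x, z\<^sub>s)"
  using F_x_ineq[of x\<^sub>s z\<^sub>s x] by (simp add: Saddle_iff)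

text \<open>The left side is half the derivative of the squared distance. Convexity bounds its
  \<open>x\<close>-part by \<open>F (x\<^sub>s, z) - F (x, z)\<close>, affinity makes its
  \<open>z\<close>-part equal to \<open>F (x, z) - F (x, z\<^sub>s)\<close>, and
  \<open>F (x, z)\<close> cancels in the sum. Since \<open>Gz\<close> vanishes at the saddle point,
  \<open>F (x\<^sub>s, z)\<close> equals \<open>F (x\<^sub>s, z\<^sub>s)\<close>.\<close>

lemma lyapunov_derivative_le:
  assumes "(x\<^sub>s, z\<^sub>s) \<in> Saddle F"
  shows "(p - (x\<^sub>s, z\<^sub>s)) \<bullet> X_sp F p \<le> F (x\<^sub>s, z\<^sub>s) - F (fst p, z\<^sub>s)"
proof (cases p)
  case (Pair x z)
  have "F (x\<^sub>s, z) = F (x\<^sub>s, z\<^sub>s)"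
    using F_z_eq[of x\<^sub>s z z\<^sub>s] assms by (simp add: Saddle_iff)
  then show ?thesis
    using F_x_ineq[of x z x\<^sub>s] F_z_eq[of x z\<^sub>s z]
    by (simp add: Pair X_sp_eq inner_diff_left)
qed

section \<open>Asymptotics of a single trajectory\<close>

context
  fixes \<phi> :: "real \<Rightarrow> 'a \<times> 'b"
  assumes traj: "trajectory (X_sp F) \<phi>"
begin

lemma has_derivative_traj:
  "t \<ge> 0 \<Longrightarrow> (\<phi> has_derivative (\<lambda>s. s *\<^sub>R X_sp F (\<phi> t))) (at t within {0..})"
  using traj by (simp add: trajectory_def has_vector_derivative_def)

lemma lyapunov_has_derivative:
  assumes "t \<ge> 0"
  shows "((\<lambda>t. (\<phi> t - p) \<bullet> (\<phi> t - p)) has_real_derivative 2 * ((\<phi> t - p) \<bullet> X_sp F (\<phi> t)))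
    (at t within {0..})"
  unfolding has_field_derivative_def
  by (rule has_derivative_eq_rhs, (rule derivative_intros has_derivative_traj assms)+)
    (auto simp: inner_commute algebra_simps)

lemma lyapunov_decreasing:
  assumes "p \<in> Saddle F" "0 \<le> a" "a \<le> b"
  shows "(\<phi> b - p) \<bullet> (\<phi> b - p) \<le> (\<phi> a - p) \<bullet> (\<phi> a - p)"
proof (rule DERIV_nonpos_atLeast_antimono[OF lyapunov_has_derivative])
  fix t :: real
  obtain x\<^sub>s z\<^sub>s where p: "p = (x\<^sub>s, z\<^sub>s)"
    by (cases p)
  with assms(1) have "(\<phi> t - p) \<bullet> X_sp F (\<phi> t) \<le> F (x\<^sub>s, z\<^sub>s) - F (fst (\<phi> t), z\<^sub>s)"
    using lyapunov_derivative_le by simp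
  also have "\<dots> \<le> 0"
    using Saddle_le assms(1) p by simp
  finally show "2 * ((\<phi> t - p) \<bullet> X_sp F (\<phi> t)) \<le> 0"
    by simp
qed (use assms in auto)

lemma dist_Saddle_decreasing:
  assumes "p \<in> Saddle F" "0 \<le> a" "a \<le> b"
  shows "dist (\<phi> b) p \<le> dist (\<phi> a) p"
  using lyapunov_decreasing[OF assms] by (simp add: dist_norm norm_le)

lemma traj_in_compact:
  obtains K where "compact K" "\<And>t. t \<ge> 0 \<Longrightarrow> \<phi> t \<in> K"
proof -
  obtain p where "p \<in> Saddle F"
    using nonempty by blast
  then have "\<phi> t \<in> cball p (dist (\<phi> 0) p)" if "t \<ge> 0" for t
    using dist_Saddle_decreasing[of p 0 t] that by (simp add: dist_commute)
  then show thesis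
    using that compact_cball by blast
qed

text \<open>The velocity is bounded, because the continuous field is bounded on a compact set
  containing the trajectory.\<close>

lemma traj_lipschitz:
  obtains B where "\<And>s t. s \<ge> 0 \<Longrightarrow> t \<ge> 0 \<Longrightarrow> norm (\<phi> s - \<phi> t) \<le> B * norm (s - t)"
proof -
  obtain K where K: "compact K" "\<And>t. t \<ge> 0 \<Longrightarrow> \<phi> t \<in> K"
    using traj_in_compact by blast
  have "continuous_on UNIV (X_sp F)"
    unfolding X_sp_eq[abs_def] by (intro continuous_intros continuous_on_Gx continuous_on_Gz)
  then have "bounded (X_sp F ` K)"
    using K(1) by (intro compact_imp_bounded compact_continuous_image) (auto intro: continuous_on_subset)
  then obtain B where B: "\<And>q. q \<in> K \<Longrightarrow> norm (X_sp F q) \<le> B"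
    by (auto simp: bounded_iff)
  have "norm (\<phi> s - \<phi> t) \<le> B * norm (s - t)" if "s \<ge> 0" "t \<ge> 0" for s t
  proof (rule differentiable_bound[where S = "{0..}"])
    show "onorm (\<lambda>h. h *\<^sub>R X_sp F (\<phi> r)) \<le> B" if "r \<in> {0..}" for r
    proof (rule onorm_le)
      show "norm (h *\<^sub>R X_sp F (\<phi> r)) \<le> B * norm h" for h
        using mult_right_mono[OF B[OF K(2)], of r "norm h"] that by (simp add: mult.commute)
    qed
  qed (use that has_derivative_traj in auto)
  then show thesis
    using that by blast
qed

text \<open>Supplies the uniform continuity required by \<open>barbalat\<close>:
  \<open>\<phi>\<close> is Lipschitz and \<open>k\<close> is uniformly continuous on a compact set
  containing its range.\<close>

lemma uniformly_continuous_on_traj: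
  fixes k :: "'a \<times> 'b \<Rightarrow> real"
  assumes "continuous_on UNIV k"
  shows "uniformly_continuous_on {0..} (\<lambda>t. k (\<phi> t))"
proof -
  obtain K where K: "compact K" "\<And>t. t \<ge> 0 \<Longrightarrow> \<phi> t \<in> K"
    using traj_in_compact by blast
  obtain B where B: "\<And>s t. s \<ge> 0 \<Longrightarrow> t \<ge> 0 \<Longrightarrow> norm (\<phi> s - \<phi> t) \<le> B * norm (s - t)"
    using traj_lipschitz by blast
  \<comment> \<open>The absolute value is taken because \<open>lipschitz_on\<close> demands a
    nonnegative constant and the sign of \<open>B\<close> has not been recorded.\<close>
  have "(\<bar>B\<bar>)-lipschitz_on {0..} \<phi>"
  proof (rule lipschitz_onI)
    fix s t :: real assume "s \<in> {0..}" "t \<in> {0..}"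
    then have "norm (\<phi> s - \<phi> t) \<le> B * norm (s - t)"
      using B by simp
    also have "\<dots> \<le> \<bar>B\<bar> * norm (s - t)"
      by (intro mult_right_mono) auto
    finally show "dist (\<phi> s) (\<phi> t) \<le> \<bar>B\<bar> * dist s t"
      by (simp add: dist_norm)
  qed simp
  then have "uniformly_continuous_on {0..} \<phi>"
    by (rule lipschitz_on_uniformly_continuous)
  moreover have "uniformly_continuous_on (\<phi> ` {0..}) k"
    using compact_uniformly_continuous[OF continuous_on_subset[OF assms subset_UNIV] K(1)] K(2)
    unfolding uniformly_continuous_on_def by (auto 0 4 simp: image_iff)
  ultimately show ?thesis
    using uniformly_continuous_on_compose by (fastforce simp: o_def)
qed

lemma F_saddle_z_tendsto:
  assumes "(x\<^sub>s, z\<^sub>s) \<in> Saddle F"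
  shows "((\<lambda>t. F (fst (\<phi> t), z\<^sub>s) - F (x\<^sub>s, z\<^sub>s)) \<longlongrightarrow> 0) at_top"
proof -
  let ?V = "\<lambda>t. (\<phi> t - (x\<^sub>s, z\<^sub>s)) \<bullet> (\<phi> t - (x\<^sub>s, z\<^sub>s))"
  obtain L where L: "(?V \<longlongrightarrow> L) at_top"
    using decreasing_bounded_below_convergent_at_top[of ?V 0] lyapunov_decreasing[OF assms] by auto
  have k: "continuous_on UNIV (\<lambda>p. F (fst p, z\<^sub>s) - F (x\<^sub>s, z\<^sub>s))"
    by (intro continuous_intros continuous_on_compose2[OF continuous_on_F]) auto
  show ?thesis
  proof (rule barbalat[OF lyapunov_has_derivative _ _ uniformly_continuous_on_traj[OF k] L tendsto_const])
    fix t :: real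
    show nonneg: "F (fst (\<phi> t), z\<^sub>s) - F (x\<^sub>s, z\<^sub>s) \<ge> 0"
      using Saddle_le[OF assms] by simp
    \<comment> \<open>The derivative is at most minus twice the gap; one copy is dropped because the
      gap is nonnegative.\<close>
    show "2 * ((\<phi> t - (x\<^sub>s, z\<^sub>s)) \<bullet> X_sp F (\<phi> t)) \<le> 0 - (F (fst (\<phi> t), z\<^sub>s) - F (x\<^sub>s, z\<^sub>s))"
      using lyapunov_derivative_le[OF assms, of "\<phi> t"] nonneg by simp
  qed
qed

lemma Gz_tendsto: "((\<lambda>t. Gz (\<phi> t)) \<longlongrightarrow> 0) at_top"
proof -
  obtain x\<^sub>s z\<^sub>s where S: "(x\<^sub>s, z\<^sub>s) \<in> Saddle F"
    using nonempty by fastforce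
  obtain K where K: "compact K" "\<And>t. t \<ge> 0 \<Longrightarrow> \<phi> t \<in> K"
    using traj_in_compact by blast
  show ?thesis
  proof (rule tendsto_zero_at_top_if_compact[OF K continuous_on_Gz])
    fix l and r :: "nat \<Rightarrow> real"
    assume r: "filterlim r at_top sequentially" and l: "(\<lambda>n. \<phi> (r n)) \<longlonglongrightarrow> l"
    have "(\<lambda>n. F (fst (\<phi> (r n)), z\<^sub>s) - F (x\<^sub>s, z\<^sub>s)) \<longlonglongrightarrow> 0"
      using filterlim_compose[OF F_saddle_z_tendsto[OF S] r] .
    moreover have "(\<lambda>n. F (fst (\<phi> (r n)), z\<^sub>s) - F (x\<^sub>s, z\<^sub>s)) \<longlonglongrightarrow> F (fst l, z\<^sub>s) - F (x\<^sub>s, z\<^sub>s)"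
      using continuous_on_F l
      by (intro tendsto_diff isCont_tendsto_compose[of "(fst l, z\<^sub>s)" F] tendsto_intros)
        (auto simp: continuous_on_eq_continuous_at)
    ultimately have "F (fst l, z\<^sub>s) = F (x\<^sub>s, z\<^sub>s)"
      using LIMSEQ_unique by fastforce
    \<comment> \<open>Hypothesis (ii) yields a saddle point at \<open>(fst l, z\<^sub>s)\<close>,
      not at \<open>l\<close> itself; \<open>Gz_const\<close> then carries the vanishing of
      \<open>Gz\<close> over to \<open>l\<close>.\<close>
    then have "Gz (fst l, z\<^sub>s) = 0"
      using level[OF S] by (simp add: Saddle_iff)
    then show "Gz l = 0"
      using Gz_const[of "fst l" "snd l" z\<^sub>s] by simp
  qed
qed

text \<open>By affinity, \<open>F (\<phi> t)\<close> differs from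
  \<open>F (fst (\<phi> t), z\<^sub>s)\<close> by the inner product of a bounded vector with
  \<open>Gz (\<phi> t)\<close>, which tends to \<open>0\<close>. The limit is thus the saddle
  value.\<close>

lemma F_traj_tendsto: "\<exists>L. ((\<lambda>t. F (\<phi> t)) \<longlongrightarrow> L) at_top"
proof -
  obtain x\<^sub>s z\<^sub>s where S: "(x\<^sub>s, z\<^sub>s) \<in> Saddle F"
    using nonempty by fastforce
  obtain K where K: "compact K" "\<And>t. t \<ge> 0 \<Longrightarrow> \<phi> t \<in> K"
    using traj_in_compact by blast
  have "bounded ((\<lambda>p. z\<^sub>s - snd p) ` K)"
    by (intro compact_imp_bounded compact_continuous_image K continuous_intros)
  then obtain B where B: "\<And>q. q \<in> K \<Longrightarrow> norm (z\<^sub>s - snd q) \<le> B"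
    by (auto simp: bounded_iff)
  have "((\<lambda>t. (z\<^sub>s - snd (\<phi> t)) \<bullet> Gz (\<phi> t)) \<longlongrightarrow> 0) at_top"
  proof (rule Lim_null_comparison)
    show "\<forall>\<^sub>F t in at_top. norm ((z\<^sub>s - snd (\<phi> t)) \<bullet> Gz (\<phi> t)) \<le> B * norm (Gz (\<phi> t))"
      using eventually_ge_at_top[of 0]
    proof eventually_elim
      case (elim t)
      have "norm ((z\<^sub>s - snd (\<phi> t)) \<bullet> Gz (\<phi> t)) \<le> norm (z\<^sub>s - snd (\<phi> t)) * norm (Gz (\<phi> t))"
        by (simp add: Cauchy_Schwarz_ineq2)
      also have "\<dots> \<le> B * norm (Gz (\<phi> t))"
        using B[OF K(2)[OF elim]] by (intro mult_right_mono) auto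
      finally show ?case .
    qed
    show "((\<lambda>t. B * norm (Gz (\<phi> t))) \<longlongrightarrow> 0) at_top"
      by (intro tendsto_mult_right_zero tendsto_norm_zero Gz_tendsto)
  qed
  from tendsto_diff[OF F_saddle_z_tendsto[OF S] this]
  have "((\<lambda>t. F (\<phi> t) - F (x\<^sub>s, z\<^sub>s)) \<longlongrightarrow> 0) at_top"
    using F_z_eq[of "fst (\<phi> t)" z\<^sub>s "snd (\<phi> t)" for t] by simp
  then show ?thesis
    using Lim_null by blast
qed

text \<open>\<open>F\<close> need not decrease along the trajectory, so the squared norm of
  \<open>Gz\<close> enters \<open>barbalat\<close> as the vanishing error term
  \<open>e\<close>.\<close>

lemma Gx_tendsto: "((\<lambda>t. Gx (\<phi> t)) \<longlongrightarrow> 0) at_top"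
proof -
  obtain L where L: "((\<lambda>t. F (\<phi> t)) \<longlongrightarrow> L) at_top"
    using F_traj_tendsto by blast
  have k: "continuous_on UNIV (\<lambda>p. Gx p \<bullet> Gx p)"
    by (intro continuous_intros continuous_on_Gx)
  have e: "((\<lambda>t. Gz (\<phi> t) \<bullet> Gz (\<phi> t)) \<longlongrightarrow> 0) at_top"
    using tendsto_inner[OF Gz_tendsto Gz_tendsto] by simp
  have "((\<lambda>t. F (\<phi> t)) has_real_derivative Gz (\<phi> t) \<bullet> Gz (\<phi> t) - Gx (\<phi> t) \<bullet> Gx (\<phi> t))
      (at t within {0..})" if "t \<ge> 0" for t
    unfolding has_field_derivative_def
    by (rule has_derivative_eq_rhs[OF has_derivative_compose[OF has_derivative_traj[OF that] has_derivative_F]])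
      (auto simp: X_sp_eq algebra_simps)
  from barbalat[OF this _ _ uniformly_continuous_on_traj[OF k] L e]
  have "((\<lambda>t. Gx (\<phi> t) \<bullet> Gx (\<phi> t)) \<longlongrightarrow> 0) at_top"
    by simp
  then have "((\<lambda>t. sqrt (Gx (\<phi> t) \<bullet> Gx (\<phi> t))) \<longlongrightarrow> sqrt 0) at_top"
    by (rule tendsto_real_sqrt)
  then show ?thesis
    by (simp add: norm_eq_sqrt_inner[symmetric] tendsto_norm_zero_iff)
qed

lemma traj_converges_to_saddle: "\<exists>p\<in>Saddle F. (\<phi> \<longlongrightarrow> p) at_top"
proof -
  obtain K where K: "compact K" "\<And>t. t \<ge> 0 \<Longrightarrow> \<phi> t \<in> K"
    using traj_in_compact by blast
  then obtain l r where r: "strict_mono (r :: nat \<Rightarrow> nat)" and l: "((\<lambda>n. \<phi> (real n)) \<circ> r) \<longlonglongrightarrow> l"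
    unfolding compact_def by (metis of_nat_0_le_iff)
  have r': "filterlim (\<lambda>n. real (r n)) at_top sequentially"
    using filterlim_compose[OF filterlim_real_sequentially filterlim_subseq[OF r]] .
  \<comment> \<open>The codomain of \<open>k\<close> is generic because \<open>Gx\<close> and
    \<open>Gz\<close> take values in different spaces.\<close>
  have "k l = 0" if k: "continuous_on UNIV k" and "((\<lambda>t. k (\<phi> t)) \<longlongrightarrow> 0) at_top"
    for k :: "'a \<times> 'b \<Rightarrow> 'c::euclidean_space"
  proof (rule LIMSEQ_unique)
    show "(\<lambda>n. k (\<phi> (real (r n)))) \<longlonglongrightarrow> k l"
      using l by (intro isCont_tendsto_compose[OF continuous_on_interior[OF k]]) (auto simp: o_def)
    show "(\<lambda>n. k (\<phi> (real (r n)))) \<longlonglongrightarrow> 0"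
      using filterlim_compose[OF that(2) r'] .
  qed
  note limit = this
  have S: "l \<in> Saddle F"
    using limit[OF continuous_on_Gx Gx_tendsto] limit[OF continuous_on_Gz Gz_tendsto]
    by (simp add: Saddle_iff)
  \<comment> \<open>As \<open>l\<close> is itself a saddle point, the distance to it is
    nonincreasing; being small at one time \<open>r n\<close>, it stays small, which upgrades the
    subsequence limit to a full limit.\<close>
  have "(\<phi> \<longlongrightarrow> l) at_top"
  proof (rule tendstoI)
    fix \<epsilon> :: real assume "\<epsilon> > 0"
    then obtain n where n: "dist (\<phi> (real (r n))) l < \<epsilon>"
      using l by (force simp: lim_sequentially)
    show "\<forall>\<^sub>F t in at_top. dist (\<phi> t) l < \<epsilon>"
      using eventually_ge_at_top[of "real (r n)"]
    proof eventually_elim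
      case (elim t)
      then show ?case
        using dist_Saddle_decreasing[OF S _ elim] n by simp
    qed
  qed
  with S show ?thesis by blast
qed

end

section \<open>Stability and convergence of all trajectories\<close>

lemma pointwise_convergent_Saddle: "pointwise_convergent (X_sp F) (Saddle F)"
  using traj_converges_to_saddle by (simp add: pointwise_convergent_def)

lemma globally_asymptotically_stable_Saddle: "globally_asymptotically_stable (X_sp F) (Saddle F)"
  unfolding globally_asymptotically_stable_def
proof (intro conjI allI impI ballI)
  show "X_sp F p = 0" if "p \<in> Saddle F" for p
    using that by (simp add: X_sp_eq_0_iff)
next
  fix \<epsilon> :: real assume "\<epsilon> > 0"
  \<comment> \<open>The radius can be \<open>\<epsilon>\<close> itself, since the distance to each
    single saddle point never grows. Bounding it one saddle point at a time avoids any compactness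
    of \<open>Saddle F\<close>.\<close>
  let ?W = "\<Union>p\<in>Saddle F. ball p \<epsilon>"
  have "infdist (\<phi> t) (Saddle F) < \<epsilon>" 
    if traj: "trajectory (X_sp F) \<phi>" and start: "\<phi> 0 \<in> ?W" and t: "t \<ge> 0" for \<phi> t
  proof -
    obtain p where p: "p \<in> Saddle F" "dist (\<phi> 0) p < \<epsilon>"
      using start by (auto simp: dist_commute)
    then show ?thesis
      using infdist_le[OF p(1), of "\<phi> t"] dist_Saddle_decreasing[OF traj p(1), of 0 t] t
      by simp
  qed
  moreover have "open ?W" "Saddle F \<subseteq> ?W"
    using \<open>\<epsilon> > 0\<close> by auto
  ultimately show "\<exists>W. open W \<and> Saddle F \<subseteq> W \<and>
      (\<forall>\<phi>. trajectory (X_sp F) \<phi> \<and> \<phi> 0 \<in> W \<longrightarrow> (\<forall>t\<ge>0. infdist (\<phi> t) (Saddle F) < \<epsilon>))"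
    by blast
next
  fix \<phi> assume "trajectory (X_sp F) \<phi>"
  then obtain p where p: "p \<in> Saddle F" "(\<phi> \<longlongrightarrow> p) at_top"
    using traj_converges_to_saddle by blast
  then show "((\<lambda>t. infdist (\<phi> t) (Saddle F)) \<longlongrightarrow> 0) at_top"
    using tendsto_infdist[OF p(2), of "Saddle F"] by simp
qed

end

theorem corollary4p5:
  fixes F :: "(real ^ 'n) \<times> (real ^ 'm) \<Rightarrow> real"
  assumes "C1 F"
    and "Saddle F \<noteq> {}"
    and "convex_concave F"
    and "linear_in_z F"
    and "\<And>x\<^sub>s z\<^sub>s x. (x\<^sub>s, z\<^sub>s) \<in> Saddle F \<Longrightarrow> F (x, z\<^sub>s) = F (x\<^sub>s, z\<^sub>s) \<Longrightarrow> (x, z\<^sub>s) \<in> Saddle F"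
  shows "globally_asymptotically_stable (X_sp F) (Saddle F)
    \<and> pointwise_convergent (X_sp F) (Saddle F)"
proof -
  interpret convex_affine_saddle F
    by unfold_locales (use assms in blast)+
  show ?thesis
    using globally_asymptotically_stable_Saddle pointwise_convergent_Saddle by blast
qed

end
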